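(* Let the nonlinear system $z_{t+1}=f(z_t,u_t)$, initialized at $z_1$, have Koopman embedding $(A,B,C,\psi)$, let $x_1=\psi(z_1)$, and let $\mathbf r=r_{1:T}$ be a target trajectory. Then: (i) $J_T(\mathbf u;\mathbf r)=J_T^{\mathrm{lft}}(\mathbf u;\mathbf r)$ for every control sequence $\mathbf u=u_{1:T}$; (ii) $J_T^*=(J_T^{\mathrm{lft}})^*$, where $J_T^*:=\min_{\mathbf u}\{J_T(\mathbf u;\mathbf r): z_{t+1}=f(z_t,u_t)\}$ and $(J_T^{\mathrm{lft}})^*:=\min_{\mathbf u}\{J_T^{\mathrm{lft}}(\mathbf u;\mathbf r): x_{t+1}=Ax_t+Bu_t\}$.
   Context: States $z_t\in\mathbb{R}^{n_z}$, inputs $u_t\in\mathbb{R}^{n_u}$, targets $r_t\in\mathbb{R}^{n_z}$ with $\|r_t\|\le1$, weights $Q_z\succeq0$, $R\succ0$; $\|x\|_P^2:=x^{\top}Px$ for $P\succeq 0$. The system $f$ has Koopman embedding $(A,B,C,\psi)$ if $\psi:\mathbb{R}^{n_z}\to\mathbb{R}^{n_x}$ and matrices $A\in\mathbb{R}^{n_x\times n_x}$, $B\in\mathbb{R}^{n_x\times n_u}$, $C\in\mathbb{R}^{n_z\times n_x}$ satisfy $\psi(f(z,u))=A\psi(z)+Bu$ and $z=C\psi(z)$ for all $z\in\mathbb{R}^{n_z}$, $u\in\mathbb{R}^{n_u}$. $J_T(\mathbf u;\mathbf r)=\sum_{t=1}^T\big(\|z_t-r_t\|_{Q_z}^2+\|u_t\|_R^2\big)$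 along $z_{t+1}=f(z_t,u_t)$ started at $z_1$. With $Q:=C^{\top}Q_zC$, $J_T^{\mathrm{lft}}(\mathbf u;\mathbf r)=\sum_{t=1}^T\big(\|x_t-\psi(r_t)\|_{Q}^2+\|u_t\|_R^2\big)$ along $x_{t+1}=Ax_t+Bu_t$ started at $x_1$. *)

theory Defs
  imports "HOL-Analysis.Analysis"
begin

definition pos_semidef :: "real^'n^'n \<Rightarrow> bool" where
  "pos_semidef P \<longleftrightarrow> transpose P = P \<and> (\<forall>x. 0 \<le> x \<bullet> (P *v x))"

definition pos_def :: "real^'n^'n \<Rightarrow> bool" where
  "pos_def P \<longleftrightarrow> transpose P = P \<and> (\<forall>x. x \<noteq> 0 \<longrightarrow> 0 < x \<bullet> (P *v x))"

definition wnorm2 :: "real^'n^'n \<Rightarrow> real^'n \<Rightarrow> real" where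
  "wnorm2 P x = x \<bullet> (P *v x)"

definition koopman_embedding ::
  "(real^'z \<Rightarrow> real^'u \<Rightarrow> real^'z) \<Rightarrow>
   real^'x^'x \<Rightarrow> real^'u^'x \<Rightarrow> real^'x^'z \<Rightarrow> (real^'z \<Rightarrow> real^'x) \<Rightarrow> bool" where
  "koopman_embedding f A B C \<psi> \<longleftrightarrow>
     (\<forall>z u. \<psi> (f z u) = A *v \<psi> z + B *v u) \<and> (\<forall>z. z = C *v \<psi> z)"

text \<open>Time starts at 1: the trajectory satisfies \<open>s\<^sub>1 = s1\<close> and
  \<open>s\<^sub>t\<^sub>+\<^sub>1 = g s\<^sub>t u\<^sub>t\<close> for \<open>t \<ge> 1\<close>. The value at index 0 carries no
  meaning and does not enter the costs below. Likewise, sequences indexed by \<open>1, \<dots>, T\<close> are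
  functions on \<^typ>\<open>nat\<close> of which the costs use only the values at these indices.\<close>

primrec traj :: "('s \<Rightarrow> 'i \<Rightarrow> 's) \<Rightarrow> 's \<Rightarrow> (nat \<Rightarrow> 'i) \<Rightarrow> nat \<Rightarrow> 's" where
  "traj g s1 u 0 = s1"
| "traj g s1 u (Suc t) = (if t = 0 then s1 else g (traj g s1 u t) (u t))"

definition J_cost ::
  "(real^'z \<Rightarrow> real^'u \<Rightarrow> real^'z) \<Rightarrow> real^'z \<Rightarrow> real^'z^'z \<Rightarrow> real^'u^'u \<Rightarrow>
   nat \<Rightarrow> (nat \<Rightarrow> real^'z) \<Rightarrow> (nat \<Rightarrow> real^'u) \<Rightarrow> real" where
  "J_cost f z1 Qz R T r u =
     (\<Sum>t=1..T. wnorm2 Qz (traj f z1 u t - r t) + wnorm2 R (u t))"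

definition J_lft ::
  "real^'x^'x \<Rightarrow> real^'u^'x \<Rightarrow> real^'x^'z \<Rightarrow> (real^'z \<Rightarrow> real^'x) \<Rightarrow> real^'x \<Rightarrow>
   real^'z^'z \<Rightarrow> real^'u^'u \<Rightarrow> nat \<Rightarrow> (nat \<Rightarrow> real^'z) \<Rightarrow> (nat \<Rightarrow> real^'u) \<Rightarrow> real" where
  "J_lft A B C \<psi> x1 Qz R T r u =
     (let Q = transpose C ** Qz ** C in
      \<Sum>t=1..T. wnorm2 Q (traj (\<lambda>x v. A *v x + B *v v) x1 u t - \<psi> (r t)) + wnorm2 R (u t))"

text \<open>The optimal values are minima over all control sequences. They are defined as infima;
  that these are attained has to be asserted separately wherever a minimum is meant.\<close>

definition J_opt ::
  "(real^'z \<Rightarrow> real^'u \<Rightarrow> real^'z) \<Rightarrow> real^'z \<Rightarrow> real^'z^'z \<Rightarrow> real^'u^'u \<Rightarrow>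
   nat \<Rightarrow> (nat \<Rightarrow> real^'z) \<Rightarrow> real" where
  "J_opt f z1 Qz R T r = (INF u. J_cost f z1 Qz R T r u)"

definition J_lft_opt ::
  "real^'x^'x \<Rightarrow> real^'u^'x \<Rightarrow> real^'x^'z \<Rightarrow> (real^'z \<Rightarrow> real^'x) \<Rightarrow> real^'x \<Rightarrow>
   real^'z^'z \<Rightarrow> real^'u^'u \<Rightarrow> nat \<Rightarrow> (nat \<Rightarrow> real^'z) \<Rightarrow> real" where
  "J_lft_opt A B C \<psi> x1 Qz R T r = (INF u. J_lft A B C \<psi> x1 Qz R T r u)"

end

theory Submission imports Defs begin

text \<open>
  Along a trajectory of \<open>f\<close>, the embedding equation makes \<open>\<psi> z\<^sub>t\<close> a trajectory of the linear
  system (\<open>traj_semiconj\<close>). Since \<open>C *v \<psi> z = z\<close>, the weight \<open>Q = C\<^sup>T Q\<^sub>z C\<close> measures lifted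
  errors \<open>\<psi> z\<^sub>t - \<psi> r\<^sub>t\<close> exactly as \<open>Q\<^sub>z\<close> measures \<open>z\<^sub>t - r\<^sub>t\<close> (\<open>wnorm2_congruence\<close>). The two
  costs are therefore the same function of the control sequence, and so have the same infimum
  and the same minimizers.

  It remains to see that a minimizer exists. The lifted side shows this: its dynamics are linear,
  so its states depend continuously on the controls, whatever \<open>f\<close> and \<open>\<psi>\<close> are. Since \<open>R\<close>
  is positive definite, it dominates a multiple of the squared norm (\<open>pos_def_coercive\<close>), and
  as the state cost is nonnegative, controls that do no worse than \<open>u = 0\<close> are bounded on the
  horizon. Uniformly bounded control sequences form a compact set in the product topology, by Tychonoff,
  and a continuous function attains its minimum there (\<open>J_lft_attains_min\<close>).
\<close>

lemma wnorm2_congruence: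
  fixes C :: "real^'n^'m" and P :: "real^'m^'m"
  shows "wnorm2 (transpose C ** P ** C) x = wnorm2 P (C *v x)"
  unfolding wnorm2_def
  by (metis dot_lmul_matrix inner_commute matrix_vector_mul_assoc transpose_matrix_vector
      transpose_transpose)

lemma continuous_on_wnorm2 [continuous_intros]:
  fixes P :: "real^'n^'n"
  assumes "continuous_on S g"
  shows "continuous_on S (\<lambda>x. wnorm2 P (g x))"
  unfolding wnorm2_def
  by (intro continuous_on_inner assms
      bounded_linear.continuous_on[OF matrix_vector_mul_bounded_linear])

lemma wnorm2_scaleR:
  fixes P :: "real^'n^'n"
  shows "wnorm2 P (c *\<^sub>R x) = c\<^sup>2 * wnorm2 P x"
  unfolding wnorm2_def by (simp add: matrix_vector_mult_scaleR power2_eq_square)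

text \<open>The constant is the minimum of the quadratic form on the unit sphere, which is compact;
  homogeneity carries the bound to all vectors.\<close>

lemma pos_def_coercive:
  fixes R :: "real^'n^'n"
  assumes "pos_def R"
  obtains c where "c > 0" and "\<And>v. c * (norm v)\<^sup>2 \<le> wnorm2 R v"
proof -
  let ?S = "sphere (0 :: real^'n) 1"
  have "?S \<noteq> {}" by simp
  then obtain w where w: "w \<in> ?S" and min: "\<And>v. v \<in> ?S \<Longrightarrow> wnorm2 R w \<le> wnorm2 R v"
    using continuous_attains_inf[OF compact_sphere, of 0 1 "wnorm2 R"]
      continuous_on_wnorm2[OF continuous_on_id, of ?S R] by auto
  show thesis
  proof
    from w have "w \<noteq> 0" by auto
    with assms show "wnorm2 R w > 0" by (simp add: pos_def_def wnorm2_def)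
    fix v :: "real^'n"
    show "wnorm2 R w * (norm v)\<^sup>2 \<le> wnorm2 R v"
    proof (cases "v = 0")
      case True
      then show ?thesis by (simp add: wnorm2_def)
    next
      case False
      let ?e = "v /\<^sub>R norm v"
      from False have "wnorm2 R w \<le> wnorm2 R ?e" by (intro min) simp
      moreover have "wnorm2 R v = (norm v)\<^sup>2 * wnorm2 R ?e"
        using False wnorm2_scaleR[of R "norm v" ?e] by simp
      ultimately show ?thesis by (metis mult.commute mult_left_mono zero_le_power2)
    qed
  qed
qed

lemma traj_semiconj:
  assumes "\<And>s v. \<psi> (g s v) = h (\<psi> s) v"
  shows "traj h (\<psi> s1) u t = \<psi> (traj g s1 u t)"
  by (induction t) (simp_all add: assms)

lemma traj_cong:
  assumes "\<And>k. k \<in> {1..<t} \<Longrightarrow> u k = v k"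
  shows "traj g s1 u t = traj g s1 v t"
  using assms by (induction t) simp_all

text \<open>Control sequences carry the product topology, in which each \<open>u t\<close> depends continuously
  on \<open>u\<close>; a state is a composition of finitely many such evaluations with the dynamics.\<close>

lemma continuous_on_traj:
  fixes g :: "'s::topological_space \<Rightarrow> 'i::topological_space \<Rightarrow> 's"
  assumes "continuous_on UNIV (\<lambda>(s, v). g s v)"
  shows "continuous_on UNIV (\<lambda>u. traj g s1 u t)"
proof (induction t)
  case (Suc t)
  have "continuous_on UNIV (\<lambda>u. (\<lambda>(s, v). g s v) (traj g s1 u t, u t))"
    by (rule continuous_on_compose2[OF assms])
      (auto intro: continuous_on_Pair Suc continuous_on_product_coordinates)
  then show ?case by (cases "t = 0") simp_all
qed simp

lemma compact_bounded_sequences: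
  fixes M :: real
  shows "compact {u :: nat \<Rightarrow> 'a::euclidean_space. \<forall>t. norm (u t) \<le> M}"
proof -
  have "compactin (product_topology (\<lambda>_. euclidean) UNIV) (\<Pi>\<^sub>E t\<in>(UNIV :: nat set). cball (0::'a) M)"
    by (subst compactin_PiE) simp
  moreover have "(\<Pi>\<^sub>E t\<in>(UNIV :: nat set). cball (0::'a) M) = {u. \<forall>t. norm (u t) \<le> M}"
    by (auto simp: PiE_def Pi_def)
  ultimately show ?thesis by (simp add: euclidean_product_topology)
qed

lemma J_lft_cong:
  assumes "\<And>t. t \<in> {1..T} \<Longrightarrow> u t = v t"
  shows "J_lft A B C \<psi> x1 Qz R T r u = J_lft A B C \<psi> x1 Qz R T r v"
proof -
  have "traj g x1 u t = traj g x1 v t" if "t \<in> {1..T}" for g t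
    using that by (intro traj_cong assms) auto
  then show ?thesis by (simp add: J_lft_def assms)
qed

lemma continuous_on_J_lft:
  "continuous_on UNIV (J_lft A B C \<psi> x1 Qz R T r)"
proof -
  have "continuous_on UNIV (\<lambda>(s, v). A *v s + B *v v)"
    unfolding case_prod_unfold
    by (intro continuous_intros
        bounded_linear.continuous_on[OF matrix_vector_mul_bounded_linear])
  from continuous_on_traj[OF this] show ?thesis
    unfolding J_lft_def Let_def
    by (intro continuous_intros continuous_on_product_coordinates)
qed

text \<open>The zero control sets the level: coercivity of \<open>R\<close> turns its cost into a bound \<open>M\<close> on every
  control that does no worse, so a minimizer over the compact set of \<open>M\<close>-bounded sequences, which
  contains zero, is a minimizer over all.\<close>

lemma J_lft_attains_min:
  fixes B :: "real^'u^'x"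
  assumes Qz: "pos_semidef Qz" and R: "pos_def R"
  obtains w where "\<And>u. J_lft A B C \<psi> x1 Qz R T r w \<le> J_lft A B C \<psi> x1 Qz R T r u"
proof -
  define F where "F = J_lft A B C \<psi> x1 Qz R T r"
  obtain c where c: "c > 0" "\<And>v. c * (norm v)\<^sup>2 \<le> wnorm2 R v"
    using pos_def_coercive[OF R] by blast
  have R_nonneg: "0 \<le> wnorm2 R v" for v
    using c(2)[of v] c(1) by (smt (verit) mult_nonneg_nonneg zero_le_power2)
  have Q_nonneg: "0 \<le> wnorm2 (transpose C ** Qz ** C) x" for x
    unfolding wnorm2_congruence using Qz by (simp add: pos_semidef_def wnorm2_def)
  have control_le: "wnorm2 R (u t) \<le> F u" if "t \<in> {1..T}" for u t
  proof -
    let ?a = "\<lambda>t. wnorm2 (transpose C ** Qz ** C)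
      (traj (\<lambda>x v. A *v x + B *v v) x1 u t - \<psi> (r t))"
    have "wnorm2 R (u t) \<le> ?a t + wnorm2 R (u t)" by (simp add: Q_nonneg)
    also have "\<dots> \<le> (\<Sum>t=1..T. ?a t + wnorm2 R (u t))"
      using that by (intro member_le_sum) (auto simp: Q_nonneg R_nonneg add_nonneg_nonneg)
    finally show ?thesis by (simp add: F_def J_lft_def)
  qed
  define M where "M = sqrt (F (\<lambda>_. 0) / c)"
  define K where "K = {u :: nat \<Rightarrow> real^'u. \<forall>t. norm (u t) \<le> M}"
  have bound: "norm (u t) \<le> M" if "F u \<le> F (\<lambda>_. 0)" "t \<in> {1..T}" for u t
  proof -
    have "c * (norm (u t))\<^sup>2 \<le> F (\<lambda>_. 0)"
      using c(2)[of "u t"] control_le[of t u] that by linarith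
    then show ?thesis
      unfolding M_def using c(1) by (intro real_le_rsqrt) (simp add: field_simps)
  qed
  have "0 \<le> F (\<lambda>_. 0)"
    unfolding F_def J_lft_def Let_def by (intro sum_nonneg add_nonneg_nonneg Q_nonneg R_nonneg)
  then have zero: "(\<lambda>_. 0) \<in> K" using c(1) by (simp add: K_def M_def)
  have "compact K" unfolding K_def by (rule compact_bounded_sequences)
  moreover have "continuous_on K F"
    unfolding F_def by (rule continuous_on_subset[OF continuous_on_J_lft]) simp
  ultimately obtain w where w: "\<And>u. u \<in> K \<Longrightarrow> F w \<le> F u"
    using continuous_attains_inf[of K F] zero by blast
  have "F w \<le> F u" for u
  proof (cases "F u \<le> F (\<lambda>_. 0)")
    case True
    \<comment> \<open>Only the controls on the horizon are bounded, but the others do not affect the cost.\<close>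
    let ?u = "\<lambda>t. if t \<in> {1..T} then u t else 0"
    from zero have "0 \<le> M" by (simp add: K_def)
    with bound[OF True] have "?u \<in> K" by (simp add: K_def)
    then have "F w \<le> F ?u" by (rule w)
    also have "F ?u = F u" unfolding F_def by (rule J_lft_cong) simp
    finally show ?thesis .
  next
    case False
    with w[OF zero] show ?thesis by linarith
  qed
  then show thesis using that unfolding F_def by blast
qed

lemma J_cost_eq_J_lft:
  assumes "koopman_embedding f A B C \<psi>"
  shows "J_cost f z1 Qz R T r u = J_lft A B C \<psi> (\<psi> z1) Qz R T r u"
proof -
  have step: "\<psi> (f z v) = A *v \<psi> z + B *v v" and dec: "C *v \<psi> z = z" for z v
    using assms by (simp_all add: koopman_embedding_def)
  have "traj (\<lambda>x v. A *v x + B *v v) (\<psi> z1) u t = \<psi> (traj f z1 u t)" for t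
    by (rule traj_semiconj) (rule step)
  then show ?thesis
    by (simp add: J_cost_def J_lft_def wnorm2_congruence matrix_vector_mult_diff_distrib dec)
qed

theorem lemma3p1:
  fixes f :: "real^'z \<Rightarrow> real^'u \<Rightarrow> real^'z"
    and A :: "real^'x^'x" and B :: "real^'u^'x" and C :: "real^'x^'z"
    and \<psi> :: "real^'z \<Rightarrow> real^'x"
    and Qz :: "real^'z^'z" and R :: "real^'u^'u"
    and z1 :: "real^'z" and x1 :: "real^'x"
    and T :: nat and r :: "nat \<Rightarrow> real^'z"
  assumes "koopman_embedding f A B C \<psi>"
    and "pos_semidef Qz" and "pos_def R"
    and "x1 = \<psi> z1"
    and "\<forall>t\<in>{1..T}. norm (r t) \<le> 1"
  shows "(\<forall>u. J_cost f z1 Qz R T r u = J_lft A B C \<psi> x1 Qz R T r u)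
    \<and> (\<exists>u. J_cost f z1 Qz R T r u = J_opt f z1 Qz R T r)
    \<and> (\<exists>u. J_lft A B C \<psi> x1 Qz R T r u = J_lft_opt A B C \<psi> x1 Qz R T r)
    \<and> J_opt f z1 Qz R T r = J_lft_opt A B C \<psi> x1 Qz R T r"
proof -
  have eq: "J_cost f z1 Qz R T r = J_lft A B C \<psi> x1 Qz R T r"
    using J_cost_eq_J_lft[OF assms(1)] assms(4) by blast
  obtain w where "\<And>u. J_lft A B C \<psi> x1 Qz R T r w \<le> J_lft A B C \<psi> x1 Qz R T r u"
    using J_lft_attains_min[OF assms(2,3)] by blast
  then have "J_lft A B C \<psi> x1 Qz R T r w = J_lft_opt A B C \<psi> x1 Qz R T r"
    unfolding J_lft_opt_def by (intro cInf_eq_minimum[symmetric]) auto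
  then show ?thesis unfolding J_opt_def J_lft_opt_def eq by blast
qed

end
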